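(* Let $\Sigma=\{\mathcal{X}=(\xi,A),\Delta^L\}$ be a simple ARS on $G(\theta)$ with $A\neq0$, with singular locus $\mathcal{Z}=\{(t,v)\in G(\theta):\mathcal{X}(t,v)\in\Delta^L(t,v)\}$, and let $(a,w)\in\mathfrak{g}(\theta)$. If $(t,v)\in G(\theta)\setminus\mathcal{Z}$, then the exponential curve $s\in\mathbb{R}\mapsto (t,v)\exp s(a,w)$ satisfies one of the following: 1. $s\mapsto (t,v)\exp s(a,w)$ remains, for all $s\in\mathbb{R}$, in the connected component of $G(\theta)\setminus\mathcal{Z}$ that contains $(t,v)$; or 2. $s\mapsto (t,v)\exp s(a,w)$ intersects $\mathcal{Z}$ discretely, i.e. $\{s\in\mathbb{R}:(t,v)\exp s(a,w)\in\mathcal{Z}\}$ is a discrete subset of $\mathbb{R}$.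
   Context: Admissible matrices: $\theta$ is a real $2\times2$ matrix of one of the types $\begin{pmatrix}1&1\\0&1\end{pmatrix}$; $\begin{pmatrix}1&0\\0&\lambda\end{pmatrix}$ with $\lambda\in[-1,1]$; $\begin{pmatrix}\lambda&-1\\1&\lambda\end{pmatrix}$ with $\lambda\in\mathbb{R}$. $\mathfrak{g}(\theta)=\mathbb{R}\times_\theta\mathbb{R}^2$ is the 3-dimensional Lie algebra on $\mathbb{R}\times\mathbb{R}^2$ with bracket $[(a_1,w_1),(a_2,w_2)]=(0,\,a_1\theta w_2-a_2\theta w_1)$. $G(\theta)=\mathbb{R}\times_\rho\mathbb{R}^2$ is the connected, simply connected Lie group with Lie algebra $\mathfrak{g}(\theta)$ and product $(t_1,v_1)(t_2,v_2)=(t_1+t_2,\,v_1+\rho_{t_1}v_2)$, where $\rho_t=e^{t\theta}$. For a $2\times 2$ matrix $B$, $\Lambda^B_t w=\int_0^t e^{sB}w\,ds$. The exponential map is $\exp(0,w)=(0,w)$ and $\exp(a,w)=(a,\frac1a\Lambda_a^\theta w)$ for $a\neq0$. Linear vector fields: a vector field $\mathcal{X}$ on $G(\theta)$ is linear if it is complete and its flow is a 1-parameter group of automorphisms of $G(\theta)$. These are exactly the vector fields $\mathcal{X}(t,v)=(0,\,Av+\Lambda_t^\theta\xi)$ with $\xi\in\mathbb{R}^2$, $A\in\mathfrak{gl}(2,\mathbb{R})$, $A\theta=\theta A$; one writes $\mathcal{X}=(\xi,A)$. The associated derivation of $\mathfrak{g}(\theta)$ is $\mathcal{D}(a,w)=(0,\,a\xi+Aw)$.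 Left-invariant distributions: for a 2-dimensional subspace $\Delta\subset\mathfrak{g}(\theta)$, $\Delta^L(t,v)=(dL_{(t,v)})_{(0,0)}\Delta=\{(a,\rho_t w):(a,w)\in\Delta\}$. An inner product on $\Delta$ induces a left-invariant Euclidean metric on $\Delta^L$. LARC: $\Sigma=\{\mathcal{X},\Delta^L\}$ satisfies the Lie algebra rank condition (LARC) if either $\Delta$ is not a subalgebra of $\mathfrak{g}(\theta)$, or $\Delta$ is a subalgebra and $\mathcal{D}\Delta\not\subset\Delta$. Simple ARS: a simple ARS (also called just an ARS) on $G(\theta)$ is a family $\Sigma=\{\mathcal{X},\Delta^L\}$ with $\mathcal{X}$ a linear vector field and $\Delta^L$ a 2-dimensional left-invariant distribution with a left-invariant Euclidean metric, such that (i) $\{(t,v):\mathcal{X}(t,v)\notin\Delta^L(t,v)\}\neq\emptyset$ and (ii) $\Sigma$ satisfies the LARC. *)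

theory Defs
  imports "HOL-Analysis.Analysis"
begin

text \<open>
  The Lie algebra \<open>\<gg>(\<theta>)\<close>, the group \<open>G(\<theta>)\<close> and each tangent space of \<open>G(\<theta>)\<close> have the
  same underlying set \<open>\<real> \<times> \<real>\<^sup>2\<close>; the structure depends on the matrix \<open>\<theta>\<close>, which is
  an argument of the operations below.
\<close>

type_synonym mat2 = "real ^ 2 ^ 2"
type_synonym space3 = "real \<times> (real ^ 2)"

text \<open>The matrices are listed by rows.\<close>

definition admissible :: "mat2 \<Rightarrow> bool" where
  "admissible \<theta> \<longleftrightarrow>
     \<theta> = vector [vector [1, 1], vector [0, 1]] \<or>
     (\<exists>l\<in>{-1..1}. \<theta> = vector [vector [1, 0], vector [0, l]]) \<or>
     (\<exists>l. \<theta> = vector [vector [l, -1], vector [1, l]])"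

text \<open>
  The type of matrices carries the componentwise product, so neither \<open>^\<close> nor the
  library's \<open>exp\<close> is the matrix operation; \<open>**\<close> is the matrix product.
\<close>

definition mat_power :: "mat2 \<Rightarrow> nat \<Rightarrow> mat2" where
  "mat_power B n = (((**) B) ^^ n) (mat 1)"

definition mat_exp :: "mat2 \<Rightarrow> mat2" where
  "mat_exp B = (\<Sum>n. (1 / fact n) *\<^sub>R mat_power B n)"

definition rho :: "mat2 \<Rightarrow> real \<Rightarrow> mat2" where
  "rho \<theta> t = mat_exp (t *\<^sub>R \<theta>)"

text \<open>The interval integral is oriented, as needed for \<open>t < 0\<close>.\<close>

definition Lam :: "mat2 \<Rightarrow> real \<Rightarrow> real ^ 2 \<Rightarrow> real ^ 2" where
  "Lam B t w = (LBINT s=ereal 0..ereal t. mat_exp (s *\<^sub>R B) *v w)"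

definition lie_bracket :: "mat2 \<Rightarrow> space3 \<Rightarrow> space3 \<Rightarrow> space3" where
  "lie_bracket \<theta> = (\<lambda>(a1, w1) (a2, w2). (0, a1 *\<^sub>R (\<theta> *v w2) - a2 *\<^sub>R (\<theta> *v w1)))"

definition gmult :: "mat2 \<Rightarrow> space3 \<Rightarrow> space3 \<Rightarrow> space3" where
  "gmult \<theta> = (\<lambda>(t1, v1) (t2, v2). (t1 + t2, v1 + rho \<theta> t1 *v v2))"

definition gexp :: "mat2 \<Rightarrow> space3 \<Rightarrow> space3" where
  "gexp \<theta> = (\<lambda>(a, w). if a = 0 then (0, w) else (a, (1 / a) *\<^sub>R Lam \<theta> a w))"

text \<open>
  Smoothness is expressed through directional derivatives, because
  the space of iterated Frechet derivatives would change its type with the order.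
  On a finite-dimensional space this is the usual \<open>C\<^sup>\<infinity>\<close>.
\<close>

primrec C_diff :: "nat \<Rightarrow> ('a::euclidean_space \<Rightarrow> 'b::euclidean_space) \<Rightarrow> bool" where
  "C_diff 0 f \<longleftrightarrow> continuous_on UNIV f"
| "C_diff (Suc n) f \<longleftrightarrow>
     (\<forall>x. f differentiable (at x)) \<and> (\<forall>h. C_diff n (\<lambda>x. frechet_derivative f (at x) h))"

definition smooth_map :: "('a::euclidean_space \<Rightarrow> 'b::euclidean_space) \<Rightarrow> bool" where
  "smooth_map f \<longleftrightarrow> (\<forall>n. C_diff n f)"

definition lie_automorphism :: "mat2 \<Rightarrow> (space3 \<Rightarrow> space3) \<Rightarrow> bool" where
  "lie_automorphism \<theta> f \<longleftrightarrow>
     bij f \<and> smooth_map f \<and> smooth_map (inv f) \<and>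
     (\<forall>p q. f (gmult \<theta> p q) = gmult \<theta> (f p) (f q))"

definition linear_vector_field :: "mat2 \<Rightarrow> (space3 \<Rightarrow> space3) \<Rightarrow> bool" where
  "linear_vector_field \<theta> X \<longleftrightarrow>
     smooth_map X \<and>
     (\<exists>\<phi> :: real \<Rightarrow> space3 \<Rightarrow> space3.
        (\<forall>p. \<phi> 0 p = p) \<and>
        (\<forall>p s. ((\<lambda>s. \<phi> s p) has_vector_derivative X (\<phi> s p)) (at s)) \<and>
        (\<forall>r s p. \<phi> (r + s) p = \<phi> r (\<phi> s p)) \<and>
        (\<forall>s. lie_automorphism \<theta> (\<phi> s)))"

definition lin_field :: "mat2 \<Rightarrow> real ^ 2 \<Rightarrow> mat2 \<Rightarrow> space3 \<Rightarrow> space3" where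
  "lin_field \<theta> \<xi> A = (\<lambda>(t, v). (0, A *v v + Lam \<theta> t \<xi>))"

definition derivation :: "real ^ 2 \<Rightarrow> mat2 \<Rightarrow> space3 \<Rightarrow> space3" where
  "derivation \<xi> A = (\<lambda>(a, w). (0, a *\<^sub>R \<xi> + A *v w))"

definition left_distribution :: "mat2 \<Rightarrow> space3 set \<Rightarrow> space3 \<Rightarrow> space3 set" where
  "left_distribution \<theta> \<Delta> p = frechet_derivative (gmult \<theta> p) (at (0, 0)) ` \<Delta>"

definition inner_product_on :: "space3 set \<Rightarrow> (space3 \<Rightarrow> space3 \<Rightarrow> real) \<Rightarrow> bool" where
  "inner_product_on \<Delta> g \<longleftrightarrow>
     (\<forall>x\<in>\<Delta>. \<forall>y\<in>\<Delta>. g x y = g y x) \<and>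
     (\<forall>x\<in>\<Delta>. \<forall>y\<in>\<Delta>. \<forall>z\<in>\<Delta>. g (x + y) z = g x z + g y z) \<and>
     (\<forall>c. \<forall>x\<in>\<Delta>. \<forall>y\<in>\<Delta>. g (c *\<^sub>R x) y = c * g x y) \<and>
     (\<forall>x\<in>\<Delta>. x \<noteq> 0 \<longrightarrow> g x x > 0)"

text \<open>For a linear subspace \<open>\<Delta>\<close>, being a subalgebra means being closed under the bracket.\<close>

definition lie_subalgebra :: "mat2 \<Rightarrow> space3 set \<Rightarrow> bool" where
  "lie_subalgebra \<theta> \<Delta> \<longleftrightarrow> subspace \<Delta> \<and> (\<forall>x\<in>\<Delta>. \<forall>y\<in>\<Delta>. lie_bracket \<theta> x y \<in> \<Delta>)"

definition LARC :: "mat2 \<Rightarrow> real ^ 2 \<Rightarrow> mat2 \<Rightarrow> space3 set \<Rightarrow> bool" where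
  "LARC \<theta> \<xi> A \<Delta> \<longleftrightarrow>
     \<not> lie_subalgebra \<theta> \<Delta> \<or>
     (lie_subalgebra \<theta> \<Delta> \<and> \<not> derivation \<xi> A ` \<Delta> \<subseteq> \<Delta>)"

definition singular_locus :: "mat2 \<Rightarrow> real ^ 2 \<Rightarrow> mat2 \<Rightarrow> space3 set \<Rightarrow> space3 set" where
  "singular_locus \<theta> \<xi> A \<Delta> = {p. lin_field \<theta> \<xi> A p \<in> left_distribution \<theta> \<Delta> p}"

text \<open>
  The ARS with linear vector field \<open>(\<xi>, A)\<close> and distribution \<open>\<Delta>\<^sup>L\<close>. A left-invariant
  Euclidean metric on \<open>\<Delta>\<^sup>L\<close> is given by its value \<open>g\<close> at the identity, an inner
  product on \<open>\<Delta>\<close>. The conditions \<open>A \<theta> = \<theta> A\<close> and \<open>linear_vector_field\<close> imply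
  one another; both are part of what the notation \<open>(\<xi>, A)\<close> stands for.
\<close>

definition simple_ARS ::
  "mat2 \<Rightarrow> real ^ 2 \<Rightarrow> mat2 \<Rightarrow> space3 set \<Rightarrow> (space3 \<Rightarrow> space3 \<Rightarrow> real) \<Rightarrow> bool" where
  "simple_ARS \<theta> \<xi> A \<Delta> g \<longleftrightarrow>
     A ** \<theta> = \<theta> ** A \<and> linear_vector_field \<theta> (lin_field \<theta> \<xi> A) \<and>
     subspace \<Delta> \<and> dim \<Delta> = 2 \<and> inner_product_on \<Delta> g \<and>
     {p. lin_field \<theta> \<xi> A p \<notin> left_distribution \<theta> \<Delta> p} \<noteq> {} \<and>
     LARC \<theta> \<xi> A \<Delta>"

end

theory Submission
  imports Defs "HOL-Complex_Analysis.Complex_Analysis"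
begin

text \<open>
  In a normal vector of \<open>\<Delta>\<close> let \<open>n\<close> be the component in \<open>\<real>\<^sup>2\<close>. A point \<open>(t, v)\<close> is singular iff
  \<open>n \<bullet> \<rho>\<^sub>-\<^sub>t (A v + \<Lambda>\<^sub>t \<xi>) = 0\<close>. Along an exponential curve the left-hand side is the restriction to
  \<open>\<real>\<close> of an entire function, which is nonzero at \<open>s = 0\<close>, so its zeros are isolated. The second
  alternative therefore always holds.
\<close>

section \<open>Restrictions of entire functions to the real line\<close>

text \<open>Asking for an entire extension, rather than for real analyticity, lets sums, products,
  composites and primitives be handled by the holomorphic theory on all of the complex
  plane.\<close>

definition real_entire :: "(real \<Rightarrow> real) \<Rightarrow> bool" where
  "real_entire f \<longleftrightarrow>
     (\<exists>F. F holomorphic_on UNIV \<and> (\<forall>x. F (complex_of_real x) = complex_of_real (f x)))"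

named_theorems entire_intros

lemma real_entire_const [entire_intros]: "real_entire (\<lambda>x. c)"
  unfolding real_entire_def by (rule exI[of _ "\<lambda>z. of_real c"]) auto

lemma real_entire_ident [entire_intros]: "real_entire (\<lambda>x. x)"
  unfolding real_entire_def by (rule exI[of _ "\<lambda>z. z"]) auto

lemma real_entire_add [entire_intros]:
  assumes "real_entire f" "real_entire g"
  shows "real_entire (\<lambda>x. f x + g x)"
proof -
  obtain F G where "F holomorphic_on UNIV" "\<And>x. F (complex_of_real x) = complex_of_real (f x)"
    "G holomorphic_on UNIV" "\<And>x. G (complex_of_real x) = complex_of_real (g x)"
    using assms unfolding real_entire_def by blast
  then show ?thesis
    unfolding real_entire_def by (intro exI[of _ "\<lambda>z. F z + G z"]) (auto intro: holomorphic_intros)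
qed

lemma real_entire_mult [entire_intros]:
  assumes "real_entire f" "real_entire g"
  shows "real_entire (\<lambda>x. f x * g x)"
proof -
  obtain F G where "F holomorphic_on UNIV" "\<And>x. F (complex_of_real x) = complex_of_real (f x)"
    "G holomorphic_on UNIV" "\<And>x. G (complex_of_real x) = complex_of_real (g x)"
    using assms unfolding real_entire_def by blast
  then show ?thesis
    unfolding real_entire_def by (intro exI[of _ "\<lambda>z. F z * G z"]) (auto intro: holomorphic_intros)
qed

lemma real_entire_diff [entire_intros]:
  "real_entire f \<Longrightarrow> real_entire g \<Longrightarrow> real_entire (\<lambda>x. f x - g x)"
  using real_entire_add[OF _ real_entire_mult[OF real_entire_const[of "-1"]], of f g] by simp

lemma real_entire_sum [entire_intros]:
  "(\<And>i. i \<in> I \<Longrightarrow> real_entire (f i)) \<Longrightarrow> real_entire (\<lambda>x. \<Sum>i\<in>I. f i x)"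
  by (induction I rule: infinite_finite_induct) (auto intro: entire_intros)

text \<open>Kept out of \<open>entire_intros\<close> because its conclusion unifies with every goal;
  instances with a fixed outer function are declared instead.\<close>

lemma real_entire_compose:
  assumes "real_entire f" "real_entire g"
  shows "real_entire (\<lambda>x. f (g x))"
proof -
  obtain F G where FG: "F holomorphic_on UNIV" "\<And>x. F (complex_of_real x) = complex_of_real (f x)"
    "G holomorphic_on UNIV" "\<And>x. G (complex_of_real x) = complex_of_real (g x)"
    using assms unfolding real_entire_def by blast
  then have "(F \<circ> G) holomorphic_on UNIV"
    by (intro holomorphic_on_compose_gen[where t = UNIV]) auto
  with FG show ?thesis
    unfolding real_entire_def by (intro exI[of _ "F \<circ> G"]) auto
qed

text \<open>Absolute convergence at the real point \<open>norm z\<close> gives convergence at every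
  complex \<open>z\<close>, and a power series converging everywhere is entire.\<close>

lemma real_entire_power_series:
  fixes c :: "nat \<Rightarrow> real"
  assumes "\<And>y. summable (\<lambda>n. \<bar>c n\<bar> * y ^ n)"
  shows "real_entire (\<lambda>x. \<Sum>n. c n * x ^ n)"
proof -
  have summ: "summable (\<lambda>n. complex_of_real (c n) * z ^ n)" for z
    by (rule summable_norm_cancel) (use assms[of "norm z"] in \<open>simp add: norm_mult norm_power\<close>)
  define F where "F z = (\<Sum>n. complex_of_real (c n) * z ^ n)" for z
  have "F holomorphic_on UNIV"
    unfolding F_def using termdiffs_strong_converges_everywhere[OF summ]
    by (auto simp: holomorphic_on_def field_differentiable_def)
  moreover have "F (complex_of_real x) = complex_of_real (\<Sum>n. c n * x ^ n)" for x
  proof -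
    have "summable (\<lambda>n. c n * x ^ n)"
      by (rule summable_norm_cancel) (use assms[of "\<bar>x\<bar>"] in \<open>simp add: abs_mult power_abs\<close>)
    then show ?thesis
      unfolding F_def by (simp add: suminf_of_real)
  qed
  ultimately show ?thesis
    unfolding real_entire_def by blast
qed

text \<open>A primitive of the complex extension exists because the plane is convex; normalized to
  vanish at 0, its real part on the real line is the required \<open>h\<close>.\<close>

lemma real_entire_primitive:
  assumes "real_entire f"
  obtains h where "real_entire h" "h 0 = 0" "\<And>x. (h has_real_derivative f x) (at x)"
proof -
  obtain F where F: "F holomorphic_on UNIV" "\<And>x. F (complex_of_real x) = complex_of_real (f x)"
    using assms unfolding real_entire_def by blast
  obtain G where G: "\<And>z. (G has_field_derivative F z) (at z)"
    using holomorphic_convex_primitive'[OF convex_UNIV open_UNIV F(1)] by auto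
  define h where "h x = Re (G (complex_of_real x) - G 0)" for x
  have G': "((\<lambda>x. G (complex_of_real x)) has_vector_derivative complex_of_real (f x)) (at x)" for x
    using has_vector_derivative_real_field[OF G[of "complex_of_real x"]] F by simp
  have h: "(h has_real_derivative f x) (at x)" for x
  proof -
    have "((\<lambda>x. Re (G (complex_of_real x)) - Re (G 0)) has_vector_derivative f x) (at x)"
      using has_vector_derivative_diff_const[of "\<lambda>x. Re (G (complex_of_real x))" "Re (G 0)"]
        bounded_linear.has_vector_derivative[OF bounded_linear_Re G'[of x]] by simp
    then show ?thesis
      by (simp add: h_def[abs_def] has_real_derivative_iff_has_vector_derivative)
  qed
  \<comment> \<open>Along the real line \<open>G\<close> and \<open>h\<close> have the same
    derivative, so their difference is constant. Hence \<open>G z - G 0\<close> takes real values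
    there and extends \<open>h\<close>.\<close>
  have "G (complex_of_real x) - complex_of_real (h x) = G (complex_of_real 0) - complex_of_real (h 0)" for x
  proof (rule Derivative.has_derivative_zero_unique[of UNIV "\<lambda>x. G (complex_of_real x) - complex_of_real (h x)"])
    fix y :: real
    have "((\<lambda>x. G (complex_of_real x) - complex_of_real (h x)) has_vector_derivative 0) (at y)"
      using has_vector_derivative_diff[OF G'[of y] has_vector_derivative_of_real[OF h[of y]]] by simp
    then show "((\<lambda>x. G (complex_of_real x) - complex_of_real (h x)) has_derivative (\<lambda>h. 0)) (at y)"
      by (simp add: has_vector_derivative_def)
  qed auto
  then have "G (complex_of_real x) - G 0 = complex_of_real (h x)" for x
    by (simp add: h_def algebra_simps)
  moreover have "(\<lambda>z. G z - G 0) holomorphic_on UNIV"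
    using G by (intro holomorphic_intros) (auto simp: holomorphic_on_def field_differentiable_def)
  ultimately have "real_entire h"
    unfolding real_entire_def by blast
  then show ?thesis
    using h by (intro that[of h]) (auto simp: h_def)
qed

text \<open>Zeros of a holomorphic function on a connected open set are isolated unless it vanishes
  identically, which \<open>x0\<close> excludes. A punctured complex ball without zeros restricts to
  a punctured real interval.\<close>

lemma discrete_zeros_real_entire:
  assumes "real_entire f" "f x0 \<noteq> 0"
  shows "discrete {x. f x = 0}"
proof (rule discreteI)
  fix x assume x: "x \<in> {x. f x = 0}"
  obtain F where F: "F holomorphic_on UNIV" "\<And>x. F (complex_of_real x) = complex_of_real (f x)"
    using assms unfolding real_entire_def by blast
  obtain r where r: "0 < r" "\<And>z. z \<in> ball (complex_of_real x) r - {complex_of_real x} \<Longrightarrow> F z \<noteq> 0"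
    using isolated_zeros[OF F(1) open_UNIV connected_UNIV, of "complex_of_real x" "complex_of_real x0"]
      F x assms(2) by auto
  have "y = x" if "f y = 0" "dist x y < r" for y
    using r(2)[of "complex_of_real y"] that F(2)[of y] by (auto simp: dist_of_real)
  then show "x isolated_in {x. f x = 0}"
    using x r(1) by (auto simp: isolated_in_dist_Ex_iff)
qed

section \<open>The matrix exponential and its integral\<close>

lemma has_vector_derivative_vec_componentwise:
  fixes f :: "real \<Rightarrow> 'a::euclidean_space ^ 'n"
  assumes "\<And>i. ((\<lambda>x. f x $ i) has_vector_derivative f' $ i) (at x within S)"
  shows "(f has_vector_derivative f') (at x within S)"
  unfolding has_vector_derivative_def
proof (subst has_derivative_componentwise_within, intro ballI)
  fix b :: "'a ^ 'n" assume "b \<in> Basis"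
  then obtain i u where b: "b = axis i u" by (auto simp: Basis_vec_def)
  show "((\<lambda>x. f x \<bullet> b) has_derivative (\<lambda>x. (x *\<^sub>R f') \<bullet> b)) (at x within S)"
    using bounded_linear.has_derivative[OF bounded_linear_inner_left
        assms[of i, unfolded has_vector_derivative_def], of u]
    by (simp add: b inner_axis)
qed

lemma mat_power_Suc: "mat_power B (Suc n) = B ** mat_power B n"
  by (simp add: mat_power_def)

lemma mat_power_commute: "mat_power B n ** B = B ** mat_power B n"
proof (induction n)
  case (Suc n)
  then show ?case by (simp add: mat_power_Suc matrix_mul_assoc[symmetric])
qed (simp add: mat_power_def)

lemma mat_power_scaleR: "mat_power (c *\<^sub>R B) n = c ^ n *\<^sub>R mat_power B n"
  by (induction n)
    (simp_all add: mat_power_Suc, simp_all add: mat_power_def scalar_matrix_assoc matrix_scalar_ac mult.commute)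

text \<open>The factor 2 is the size of the matrix: an entry of a product is a sum of two terms,
  each at most \<open>norm B\<close> times the previous bound.\<close>

lemma mat_power_entry_bound: "\<bar>mat_power B n $ i $ j\<bar> \<le> (2 * norm B) ^ n"
proof (induction n arbitrary: i)
  case 0
  show ?case by (simp add: mat_power_def mat_def)
next
  case (Suc n)
  have "\<bar>B $ i $ k\<bar> \<le> norm B" for k
    using component_le_norm_cart[of "B $ i" k] Finite_Cartesian_Product.norm_nth_le[of B i]
    by (rule order_trans)
  then have "\<bar>B $ i $ k * mat_power B n $ k $ j\<bar> \<le> norm B * (2 * norm B) ^ n" for k
    unfolding abs_mult by (intro mult_mono Suc.IH) auto
  then have "(\<Sum>k\<in>UNIV. \<bar>B $ i $ k * mat_power B n $ k $ j\<bar>) \<le> (\<Sum>k\<in>(UNIV :: 2 set). norm B * (2 * norm B) ^ n)"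
    by (intro sum_mono)
  then have "\<bar>\<Sum>k\<in>UNIV. B $ i $ k * mat_power B n $ k $ j\<bar> \<le> (\<Sum>k\<in>(UNIV :: 2 set). norm B * (2 * norm B) ^ n)"
    by (rule order_trans[OF sum_abs])
  then show ?case
    by (simp add: mat_power_Suc matrix_matrix_mult_def mult.assoc)
qed

text \<open>The entry bound makes the exponential series at
  \<open>2 * norm B * \<bar>y\<bar>\<close> a majorant.\<close>

lemma summable_mat_power_entry:
  "summable (\<lambda>n. \<bar>mat_power B n $ i $ j / fact n\<bar> * y ^ n)"
proof (rule summable_comparison_test')
  show "summable (\<lambda>n. (2 * norm B * \<bar>y\<bar>) ^ n /\<^sub>R fact n)"
    by (rule summable_exp_generic)
  show "norm (\<bar>mat_power B n $ i $ j / fact n\<bar> * y ^ n) \<le> (2 * norm B * \<bar>y\<bar>) ^ n /\<^sub>R fact n" for n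
    using mult_right_mono[OF mat_power_entry_bound[of B n i j], of "\<bar>y\<bar> ^ n / fact n"]
    by (simp add: abs_mult power_abs power_mult_distrib field_simps)
qed

text \<open>Convergence of matrices is entrywise, so the matrix series reduces to scalar power
  series in \<open>t\<close>.\<close>

lemma rho_entry: "rho B t $ i $ j = (\<Sum>n. (mat_power B n $ i $ j / fact n) * t ^ n)"
proof -
  let ?T = "\<lambda>n. (1 / fact n) *\<^sub>R mat_power (t *\<^sub>R B) n"
  let ?a = "\<lambda>i j n. (mat_power B n $ i $ j / fact n) * t ^ n"
  have T: "?T n $ i $ j = ?a i j n" for n i j
    by (simp add: mat_power_scaleR)
  have a: "summable (?a i j)" for i j
    by (rule summable_norm_cancel)
      (use summable_mat_power_entry[of B i j "\<bar>t\<bar>"] in \<open>simp add: abs_mult power_abs\<close>)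
  have "(\<lambda>n. \<Sum>k<n. ?T k) \<longlonglongrightarrow> (\<chi> i j. suminf (?a i j))"
    using summable_LIMSEQ[OF a]
    by (intro vec_tendstoI) (simp add: mat_power_scaleR mult.commute)
  then have "?T sums (\<chi> i j. suminf (?a i j))"
    by (simp add: sums_def)
  then show ?thesis
    unfolding rho_def mat_exp_def by (simp only: sums_unique[symmetric] vec_lambda_beta)
qed

lemma real_entire_rho [entire_intros]:
  assumes "real_entire f"
  shows "real_entire (\<lambda>s. rho B (f s) $ i $ j)"
  unfolding rho_entry
  by (rule real_entire_compose[OF real_entire_power_series[OF summable_mat_power_entry] assms])

lemma rho_zero [simp]: "rho B 0 = mat 1"
proof -
  have "(\<Sum>n. (mat_power B n $ i $ j / fact n) * 0 ^ n) = mat 1 $ i $ j" for i j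
    using powser_zero[of "\<lambda>n. mat_power B n $ i $ j / fact n"] by (simp add: mat_power_def)
  then show ?thesis by (simp add: vec_eq_iff rho_entry)
qed

text \<open>Multiplying the series by \<open>B\<close> on either side multiplies each coefficient by
  \<open>B\<close>. The two products agree because powers of \<open>B\<close> commute with
  \<open>B\<close>, and the left one is also the termwise derivative.\<close>

lemma
  shows has_derivative_rho_left:
      "((\<lambda>t. rho B t $ i $ j) has_real_derivative (B ** rho B t) $ i $ j) (at t)" (is ?left)
    and rho_commute: "rho B t ** B = B ** rho B t"
proof -
  let ?c = "\<lambda>i j n. mat_power B n $ i $ j / fact n"
  have summ: "summable (\<lambda>n. ?c i j n * y ^ n)" for i j y
    by (rule summable_norm_cancel)
      (use summable_mat_power_entry[of B i j "\<bar>y\<bar>"] in \<open>simp add: abs_mult power_abs\<close>)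
  have rho: "(\<lambda>n. ?c i j n * t ^ n) sums (rho B t $ i $ j)" for i j
    unfolding rho_entry by (rule summable_sums[OF summ])
  have "(\<lambda>n. \<Sum>k\<in>UNIV. B $ i $ k * (?c k j n * t ^ n)) sums (B ** rho B t) $ i $ j" for i j
    unfolding matrix_matrix_mult_def vec_lambda_beta by (intro sums_sum sums_mult rho)
  then have BP: "(\<Sum>n. ((B ** mat_power B n) $ i $ j / fact n) * t ^ n) = (B ** rho B t) $ i $ j" for i j
    by (intro sums_unique[symmetric])
      (simp add: matrix_matrix_mult_def sum_divide_distrib sum_distrib_right mult.assoc)
  have "(\<lambda>n. \<Sum>k\<in>UNIV. (?c i k n * t ^ n) * B $ k $ j) sums (rho B t ** B) $ i $ j" for i j
    unfolding matrix_matrix_mult_def vec_lambda_beta by (intro sums_sum sums_mult2 rho)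
  then have PB: "(\<Sum>n. ((mat_power B n ** B) $ i $ j / fact n) * t ^ n) = (rho B t ** B) $ i $ j" for i j
    by (intro sums_unique[symmetric])
      (simp add: matrix_matrix_mult_def sum_divide_distrib sum_distrib_left mult_ac)
  show "rho B t ** B = B ** rho B t"
    by (simp add: vec_eq_iff BP[symmetric] PB[symmetric] mat_power_commute)
  \<comment> \<open>\<open>diffs\<close> shifts the index and multiplies by \<open>Suc n\<close>,
    which cancels against \<open>fact (Suc n)\<close>.\<close>
  have d: "diffs (?c i j) n = (B ** mat_power B n) $ i $ j / fact n" for n
    by (simp add: diffs_def mat_power_Suc divide_simps del: of_nat_Suc)
  then show ?left
    using termdiffs_strong_converges_everywhere[OF summ, of i j t]
    unfolding rho_entry by (simp only: d BP)
qed

text \<open>The product has zero derivative in \<open>t\<close> and is the identity at 0.\<close>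

lemma rho_mult_rho_minus: "rho B t ** rho B (- t) = mat 1"
proof -
  let ?N = "\<lambda>t. rho B t ** rho B (- t)"
  have m: "((\<lambda>t. rho B (- t) $ i $ j) has_real_derivative - (B ** rho B (- t)) $ i $ j) (at t)" for i j t
    using DERIV_chain2[where f = "\<lambda>t. rho B t $ i $ j" and g = uminus and x = t and s = UNIV,
        OF has_derivative_rho_left DERIV_minus[OF DERIV_ident]] by simp
  have "((\<lambda>t. ?N t $ i $ j) has_real_derivative 0) (at t)" for i j t
  proof -
    \<comment> \<open>In the derivative of the first factor \<open>B\<close> is moved to the right
      of \<open>rho B t\<close>, so that the two terms of the product rule cancel by associativity
      alone.\<close>
    have "((\<lambda>t. \<Sum>k\<in>UNIV. rho B t $ i $ k * rho B (- t) $ k $ j) has_real_derivative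
        (\<Sum>k\<in>UNIV. (rho B t ** B) $ i $ k * rho B (- t) $ k $ j
                    + - (B ** rho B (- t)) $ k $ j * rho B t $ i $ k)) (at t)"
      unfolding rho_commute
      by (intro DERIV_sum DERIV_mult has_derivative_rho_left m)
    also have "(\<Sum>k\<in>UNIV. (rho B t ** B) $ i $ k * rho B (- t) $ k $ j
          + - (B ** rho B (- t)) $ k $ j * rho B t $ i $ k)
        = ((rho B t ** B) ** rho B (- t)) $ i $ j - (rho B t ** (B ** rho B (- t))) $ i $ j"
      unfolding matrix_matrix_mult_def[of "rho B t ** B"] matrix_matrix_mult_def[of "rho B t" "B ** _"]
      by (simp add: sum_2 algebra_simps)
    finally show ?thesis
      by (simp add: matrix_mul_assoc) (simp add: matrix_matrix_mult_def)
  qed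
  then have "?N t $ i $ j = ?N 0 $ i $ j" for i j
    by (intro DERIV_isconst_all) blast
  then show ?thesis by (simp add: vec_eq_iff)
qed

text \<open>\<open>P\<close> consists of the primitives of the entries of \<open>rho B\<close> that
  vanish at 0. The fundamental theorem of calculus for oriented integrals identifies it with
  \<open>Lam\<close> for \<open>t\<close> of either sign.\<close>

lemma Lam_eq_entire_matrix:
  obtains P :: "real \<Rightarrow> mat2" where
    "\<And>t w. Lam B t w = P t *v w" "\<And>i j. real_entire (\<lambda>t. P t $ i $ j)"
proof -
  have "\<exists>h. real_entire h \<and> h 0 = 0 \<and> (\<forall>x. (h has_real_derivative rho B x $ i $ j) (at x))" for i j
    using real_entire_primitive[OF real_entire_rho[OF real_entire_ident]] by metis
  then obtain h where h: "\<And>i j. real_entire (h i j)" "\<And>i j. h i j 0 = 0"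
    "\<And>i j x. (h i j has_real_derivative rho B x $ i $ j) (at x)"
    by metis
  define P :: "real \<Rightarrow> mat2" where "P t = (\<chi> i j. h i j t)" for t
  have dP: "((\<lambda>t. P t *v w) has_vector_derivative rho B t *v w) (at t within S)" for w t S
  proof (rule has_vector_derivative_vec_componentwise)
    fix i
    show "((\<lambda>t. (P t *v w) $ i) has_vector_derivative (rho B t *v w) $ i) (at t within S)"
      unfolding P_def matrix_vector_mult_def
      by (auto intro!: DERIV_sum DERIV_cmult_right has_field_derivative_at_within[OF h(3)]
          simp flip: has_real_derivative_iff_has_vector_derivative)
  qed
  have "continuous_on S (\<lambda>t. rho B t $ i $ j)" for S i j
    using DERIV_isCont[OF has_derivative_rho_left] continuous_at_imp_continuous_on by blast
  then have cont: "continuous_on S (\<lambda>t. rho B t *v w)" for S w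
    unfolding matrix_vector_mult_def by (intro continuous_on_vec_lambda continuous_on_sum continuous_on_mult_right)
  have "Lam B t w = P t *v w - P 0 *v w" for t w
    unfolding Lam_def rho_def[symmetric]
    by (rule interval_integral_FTC_finite[OF cont dP])
  moreover have "P 0 *v w = 0" for w
    by (simp add: P_def h(2) matrix_vector_mult_def vec_eq_iff)
  ultimately show ?thesis
    using h(1) by (intro that[of P]) (auto simp: P_def)
qed

section \<open>The singular locus\<close>

text \<open>Left translation is affine in the coordinates, so its differential is the same at every
  \<open>p\<close>.\<close>

lemma frechet_derivative_gmult:
  "frechet_derivative (gmult B (t, v)) (at p) = (\<lambda>(a, w). (a, rho B t *v w))"
proof -
  have "(gmult B (t, v) has_derivative (\<lambda>q. (0 + fst q, 0 + rho B t *v snd q))) (at p)"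
    unfolding gmult_def split_beta fst_conv snd_conv
    by (intro has_derivative_Pair has_derivative_add has_derivative_const has_derivative_fst
        has_derivative_ident bounded_linear.has_derivative[OF matrix_vector_mul_bounded_linear]
        has_derivative_snd)
  then show ?thesis
    by (simp add: frechet_derivative_at[symmetric] split_beta')
qed

text \<open>The differential of left translation fixes the first component and acts by
  \<open>rho B t\<close> on the second, with inverse \<open>rho B (- t)\<close>. Vertical vectors
  suffice because \<open>lin_field\<close> has first component 0.\<close>

lemma left_distribution_vertical:
  "(0, y) \<in> left_distribution B \<Delta> (t, v) \<longleftrightarrow> (0, rho B (- t) *v y) \<in> \<Delta>"
proof -
  have 1: "rho B t *v (rho B (- t) *v y) = y" for y
    by (simp add: matrix_vector_mul_assoc rho_mult_rho_minus)
  have 2: "rho B (- t) *v (rho B t *v y) = y" for y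
    using rho_mult_rho_minus[of B "- t"] by (simp add: matrix_vector_mul_assoc)
  show ?thesis
    unfolding left_distribution_def frechet_derivative_gmult
    by (force simp: image_iff 1 2 intro: bexI[of _ "(0, rho B (- t) *v y)"])
qed

text \<open>The ambient dimension is 3, so the subspace lies in a hyperplane, and equal dimensions
  force equality.\<close>

lemma subspace_dim2_eq_hyperplane:
  assumes "subspace \<Delta>" "dim \<Delta> = 2"
  obtains n :: space3 where "\<Delta> = {x. n \<bullet> x = 0}"
proof -
  obtain n :: space3 where n: "n \<noteq> 0" "span \<Delta> \<subseteq> {x. n \<bullet> x = 0}"
    using lowdim_subset_hyperplane[of \<Delta>] assms(2) by auto
  have "\<Delta> = {x. n \<bullet> x = 0}"
    using assms n
    by (intro subspace_dim_equal)
      (auto simp: dim_hyperplane subspace_hyperplane dest: span_base)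
  then show ?thesis by (rule that)
qed

theorem theorem4p6:
  fixes \<theta> A :: mat2 and \<xi> w v :: "real ^ 2" and \<Delta> :: "space3 set"
    and g :: "space3 \<Rightarrow> space3 \<Rightarrow> real" and a t :: real
  assumes "admissible \<theta>"
    and "simple_ARS \<theta> \<xi> A \<Delta> g"
    and "A \<noteq> 0"
    and "(t, v) \<notin> singular_locus \<theta> \<xi> A \<Delta>"
  shows "(\<forall>s::real. gmult \<theta> (t, v) (gexp \<theta> (s *\<^sub>R (a, w)))
            \<in> connected_component_set (UNIV - singular_locus \<theta> \<xi> A \<Delta>) (t, v)) \<or>
         discrete {s::real. gmult \<theta> (t, v) (gexp \<theta> (s *\<^sub>R (a, w))) \<in> singular_locus \<theta> \<xi> A \<Delta>}"
proof (rule disjI2)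
  obtain n :: space3 where n: "\<Delta> = {x. n \<bullet> x = 0}"
    using assms(2) subspace_dim2_eq_hyperplane unfolding simple_ARS_def by metis
  obtain P :: "real \<Rightarrow> mat2" where P: "\<And>t w. Lam \<theta> t w = P t *v w" "\<And>i j. real_entire (\<lambda>t. P t $ i $ j)"
    using Lam_eq_entire_matrix by metis
  have P_comp [entire_intros]: "real_entire (\<lambda>s. P (f s) $ i $ j)" if "real_entire f" for f i j
    by (rule real_entire_compose[OF P(2) that])
  \<comment> \<open>This is the inner product of \<open>n\<close> with the field pulled back to the
    identity; the pulled-back vector is vertical, so only \<open>snd n\<close> enters.\<close>
  define \<phi> where "\<phi> t v = snd n \<bullet> (rho \<theta> (- t) *v (A *v v + P t *v \<xi>))" for t v
  have sing: "(t, v) \<in> singular_locus \<theta> \<xi> A \<Delta> \<longleftrightarrow> \<phi> t v = 0" for t v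
    by (simp add: singular_locus_def lin_field_def left_distribution_vertical n inner_prod_def P(1) \<phi>_def)
  \<comment> \<open>The second component of the exponential. For \<open>a \<noteq> 0\<close> the
    factor \<open>s\<close> of \<open>s *\<^sub>R w\<close> cancels against
    \<open>1 / (s * a)\<close>. At \<open>s = 0\<close>, where \<open>gexp\<close> switches to its
    other branch, the formula still gives the right value 0 because \<open>P 0 = 0\<close>. Thus the
    case distinction depends on \<open>a\<close> only, and each case is entire in
    \<open>s\<close>.\<close>
  define c where "c s = (if a = 0 then s *\<^sub>R w else (1 / a) *\<^sub>R (P (s * a) *v w))" for s
  have c: "real_entire (\<lambda>s. c s $ i)" for i
    unfolding c_def by (cases "a = 0")
      (simp_all add: matrix_vector_mult_def divide_inverse, (intro entire_intros)+)
  define \<gamma> where "\<gamma> s = \<phi> (t + s * a) (v + rho \<theta> t *v c s)" for s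
  have "P 0 = 0"
  proof -
    have "P 0 *v x = 0" for x
      using P(1)[of 0 x] by (simp add: Lam_def)
    then show ?thesis by (simp add: matrix_eq)
  qed
  then have "gexp \<theta> (s *\<^sub>R (a, w)) = (s * a, c s)" for s
    by (auto simp: gexp_def c_def P(1) matrix_vector_mult_scaleR)
  then have curve: "gmult \<theta> (t, v) (gexp \<theta> (s *\<^sub>R (a, w))) \<in> singular_locus \<theta> \<xi> A \<Delta> \<longleftrightarrow> \<gamma> s = 0" for s
    by (simp add: gmult_def sing \<gamma>_def)
  have "real_entire \<gamma>"
    unfolding \<gamma>_def \<phi>_def inner_vec_def matrix_vector_mult_def inner_real_def
    by (simp, intro entire_intros c)
  \<comment> \<open>Since \<open>c 0 = 0\<close>, the curve starts at \<open>(t, v)\<close>, which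
    is not singular.\<close>
  moreover have "\<gamma> 0 \<noteq> 0"
    using assms(4) \<open>P 0 = 0\<close> by (simp add: sing \<gamma>_def c_def)
  ultimately show "discrete {s::real. gmult \<theta> (t, v) (gexp \<theta> (s *\<^sub>R (a, w))) \<in> singular_locus \<theta> \<xi> A \<Delta>}"
    unfolding curve by (rule discrete_zeros_real_entire)
qed

end
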